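(* Let $(\mathcal{D},\otimes,I,s,\mathrm{Tr})$ be a partially traced category, let $(\mathcal{C},\otimes,I,s)$ be a symmetric monoidal category, and let $(F,m):\mathcal{C}\to\mathcal{D}$ be a faithful strong symmetric monoidal functor. For $f:X\otimes U\to Y\otimes U$ in $\mathcal{C}$, define $\widehat{\mathrm{Tr}}^U_{X,Y}(f)=g$ if $\mathrm{Tr}^{FU}_{FX,FY}(m_{Y,U}^{-1}\circ F(f)\circ m_{X,U})$ is defined and there exists some (necessarily unique) $g:X\to Y$ in $\mathcal{C}$ with $$F(g)=\mathrm{Tr}^{FU}_{FX,FY}\bigl(m_{Y,U}^{-1}\circ F(f)\circ m_{X,U}\bigr),$$ and let $\widehat{\mathrm{Tr}}^U_{X,Y}(f)$ be undefined otherwise. Then $\widehat{\mathrm{Tr}}$ is a partial trace on $\mathcal{C}$.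
   Context: Here $m_{A,B}:FA\otimes FB\to F(A\otimes B)$ denotes the structure isomorphisms of the strong monoidal functor $F$. For partially defined expressions, $a\simeq b$ (Kleene equality) means that $a,b$ are either both undefined, or both defined and equal; $a\lesssim b$ means that either $a$ is undefined, or both are defined and equal. A partial trace on a symmetric monoidal category $(\mathcal{C},\otimes,I,\rho,\lambda,\sigma)$ is a family of partial functions $\mathrm{Tr}^U_{X,Y}:\mathcal{C}(X\otimes U,Y\otimes U)\rightharpoonup\mathcal{C}(X,Y)$ satisfying (associativity isomorphisms suppressed): - Naturality: for $f:X\otimes U\to Y\otimes U$, $g:X'\to X$, $h:Y\to Y'$: $h\,\mathrm{Tr}^U_{X,Y}(f)\,g\lesssim \mathrm{Tr}^U_{X',Y'}((h\otimes 1_U)f(g\otimes 1_U))$. - Dinaturality: for $f:X\otimes U\to Y\otimes U'$, $g:U'\to U$: $\mathrm{Tr}^U_{X,Y}((1_Y\otimes g)f)\simeq \mathrm{Tr}^{U'}_{X,Y}(f(1_X\otimes g))$. - Vanishing I: for $f:X\otimes I\to Y\otimes I$: $\mathrm{Tr}^I_{X,Y}(f)\simeq\rho_Y f\rho_X^{-1}$, where $\rho_X:X\otimes I\to X$. - Vanishing II: for $g:X\otimes U\otimes V\to Y\otimes U\otimes V$, if $\mathrm{Tr}^V_{X\otimes U,Y\otimes U}(g)$ is defined then $\mathrm{Tr}^{U\otimes V}_{X,Y}(g)\simeq\mathrm{Tr}^U_{X,Y}(\mathrm{Tr}^V_{X\otimes U,Y\otimes U}(g))$. - Superposing: for $f:X\otimes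 U\to Y\otimes U$, $g:W\to Z$: $g\otimes\mathrm{Tr}^U_{X,Y}(f)\lesssim\mathrm{Tr}^U_{W\otimes X,Z\otimes Y}(g\otimes f)$. - Yanking: $\mathrm{Tr}^U_{U,U}(\sigma_{U,U})\simeq 1_U$. A partially traced category is a symmetric monoidal category with a partial trace. *)

theory Defs
  imports Main
begin

section \<open>Categories\<close>

text \<open>
  Objects and arrows are carrier sets; composition is in applicative order and is
  meaningful only on composable arrows. Hom-sets are disjoint, as arrows know their
  domain and codomain.
\<close>

record ('o, 'a) cat =
  Obj :: "'o set"
  Arr :: "'a set"
  Dom :: "'a \<Rightarrow> 'o"
  Cod :: "'a \<Rightarrow> 'o"
  Id :: "'o \<Rightarrow> 'a" ("\<one>\<index>")
  Comp :: "'a \<Rightarrow> 'a \<Rightarrow> 'a" (infixl "\<cdot>\<index>" 65)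

definition Hom :: "('o, 'a, 'm) cat_scheme \<Rightarrow> 'o \<Rightarrow> 'o \<Rightarrow> 'a set" where
  "Hom C X Y = {f \<in> Arr C. Dom C f = X \<and> Cod C f = Y}"

definition is_inverse :: "('o, 'a, 'm) cat_scheme \<Rightarrow> 'a \<Rightarrow> 'a \<Rightarrow> bool" where
  "is_inverse C f g \<longleftrightarrow> g \<in> Hom C (Cod C f) (Dom C f) \<and>
     Comp C g f = Id C (Dom C f) \<and> Comp C f g = Id C (Cod C f)"

definition iso :: "('o, 'a, 'm) cat_scheme \<Rightarrow> 'a \<Rightarrow> bool" where
  "iso C f \<longleftrightarrow> f \<in> Arr C \<and> (\<exists>g. is_inverse C f g)"

definition Inv :: "('o, 'a, 'm) cat_scheme \<Rightarrow> 'a \<Rightarrow> 'a" where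
  "Inv C f = (THE g. is_inverse C f g)"

locale category =
  fixes C :: "('o, 'a, 'm) cat_scheme" (structure)
  assumes Dom_Obj: "f \<in> Arr C \<Longrightarrow> Dom C f \<in> Obj C"
    and Cod_Obj: "f \<in> Arr C \<Longrightarrow> Cod C f \<in> Obj C"
    and Id_Hom: "X \<in> Obj C \<Longrightarrow> \<one> X \<in> Hom C X X"
    and Comp_Hom: "\<lbrakk>f \<in> Hom C X Y; g \<in> Hom C Y Z\<rbrakk> \<Longrightarrow> g \<cdot> f \<in> Hom C X Z"
    and Comp_assoc: "\<lbrakk>f \<in> Hom C W X; g \<in> Hom C X Y; h \<in> Hom C Y Z\<rbrakk> \<Longrightarrow>
      (h \<cdot> g) \<cdot> f = h \<cdot> (g \<cdot> f)"
    and Id_left: "f \<in> Hom C X Y \<Longrightarrow> \<one> Y \<cdot> f = f"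
    and Id_right: "f \<in> Hom C X Y \<Longrightarrow> f \<cdot> \<one> X = f"

section \<open>Symmetric monoidal categories\<close>

text \<open>
  The tensor product is written \<open>\<otimes>\<close> on objects and \<open>\<boxtimes>\<close> on arrows. Nothing is
  assumed strict: the associator is part of the data and appears explicitly throughout.
\<close>

record ('o, 'a) smcat = "('o, 'a) cat" +
  TensorO :: "'o \<Rightarrow> 'o \<Rightarrow> 'o" (infixl "\<otimes>\<index>" 70)
  TensorA :: "'a \<Rightarrow> 'a \<Rightarrow> 'a" (infixl "\<boxtimes>\<index>" 70)
  Unit :: "'o" ("\<I>\<index>")
  Assoc :: "'o \<Rightarrow> 'o \<Rightarrow> 'o \<Rightarrow> 'a" ("\<alpha>\<index>")
  Lunit :: "'o \<Rightarrow> 'a" ("\<ll>\<index>")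
  Runit :: "'o \<Rightarrow> 'a" ("\<rho>\<index>")
  Symm :: "'o \<Rightarrow> 'o \<Rightarrow> 'a" ("\<sigma>\<index>")

locale monoidal_category = category C
  for C :: "('o, 'a, 'm) smcat_scheme" (structure) +
  assumes Unit_Obj: "\<I> \<in> Obj C"
    and TensorO_Obj: "\<lbrakk>X \<in> Obj C; Y \<in> Obj C\<rbrakk> \<Longrightarrow> X \<otimes> Y \<in> Obj C"
    and TensorA_Hom: "\<lbrakk>f \<in> Hom C X Y; g \<in> Hom C Z W\<rbrakk> \<Longrightarrow>
      f \<boxtimes> g \<in> Hom C (X \<otimes> Z) (Y \<otimes> W)"
    and TensorA_Id: "\<lbrakk>X \<in> Obj C; Y \<in> Obj C\<rbrakk> \<Longrightarrow> \<one> X \<boxtimes> \<one> Y = \<one> (X \<otimes> Y)"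
    and TensorA_Comp: "\<lbrakk>f \<in> Hom C X Y; f' \<in> Hom C Y Z; g \<in> Hom C X' Y'; g' \<in> Hom C Y' Z'\<rbrakk> \<Longrightarrow>
      (f' \<cdot> f) \<boxtimes> (g' \<cdot> g) = (f' \<boxtimes> g') \<cdot> (f \<boxtimes> g)"
    and Assoc_Hom: "\<lbrakk>X \<in> Obj C; Y \<in> Obj C; Z \<in> Obj C\<rbrakk> \<Longrightarrow>
      \<alpha> X Y Z \<in> Hom C ((X \<otimes> Y) \<otimes> Z) (X \<otimes> (Y \<otimes> Z))"
    and Assoc_iso: "\<lbrakk>X \<in> Obj C; Y \<in> Obj C; Z \<in> Obj C\<rbrakk> \<Longrightarrow> iso C (\<alpha> X Y Z)"
    and Assoc_natural: "\<lbrakk>f \<in> Hom C X X'; g \<in> Hom C Y Y'; h \<in> Hom C Z Z'\<rbrakk> \<Longrightarrow>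
      \<alpha> X' Y' Z' \<cdot> ((f \<boxtimes> g) \<boxtimes> h) = (f \<boxtimes> (g \<boxtimes> h)) \<cdot> \<alpha> X Y Z"
    and Lunit_Hom: "X \<in> Obj C \<Longrightarrow> \<ll> X \<in> Hom C (\<I> \<otimes> X) X"
    and Lunit_iso: "X \<in> Obj C \<Longrightarrow> iso C (\<ll> X)"
    and Lunit_natural: "f \<in> Hom C X Y \<Longrightarrow> \<ll> Y \<cdot> (\<one> \<I> \<boxtimes> f) = f \<cdot> \<ll> X"
    and Runit_Hom: "X \<in> Obj C \<Longrightarrow> \<rho> X \<in> Hom C (X \<otimes> \<I>) X"
    and Runit_iso: "X \<in> Obj C \<Longrightarrow> iso C (\<rho> X)"
    and Runit_natural: "f \<in> Hom C X Y \<Longrightarrow> \<rho> Y \<cdot> (f \<boxtimes> \<one> \<I>) = f \<cdot> \<rho> X"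
    and pentagon: "\<lbrakk>W \<in> Obj C; X \<in> Obj C; Y \<in> Obj C; Z \<in> Obj C\<rbrakk> \<Longrightarrow>
      \<alpha> W X (Y \<otimes> Z) \<cdot> \<alpha> (W \<otimes> X) Y Z =
      (\<one> W \<boxtimes> \<alpha> X Y Z) \<cdot> \<alpha> W (X \<otimes> Y) Z \<cdot> (\<alpha> W X Y \<boxtimes> \<one> Z)"
    and triangle: "\<lbrakk>X \<in> Obj C; Y \<in> Obj C\<rbrakk> \<Longrightarrow>
      (\<one> X \<boxtimes> \<ll> Y) \<cdot> \<alpha> X \<I> Y = \<rho> X \<boxtimes> \<one> Y"

locale symmetric_monoidal_category = monoidal_category C
  for C :: "('o, 'a, 'm) smcat_scheme" (structure) +
  assumes Symm_Hom: "\<lbrakk>X \<in> Obj C; Y \<in> Obj C\<rbrakk> \<Longrightarrow> \<sigma> X Y \<in> Hom C (X \<otimes> Y) (Y \<otimes> X)"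
    and Symm_natural: "\<lbrakk>f \<in> Hom C X X'; g \<in> Hom C Y Y'\<rbrakk> \<Longrightarrow>
      \<sigma> X' Y' \<cdot> (f \<boxtimes> g) = (g \<boxtimes> f) \<cdot> \<sigma> X Y"
    and Symm_Symm: "\<lbrakk>X \<in> Obj C; Y \<in> Obj C\<rbrakk> \<Longrightarrow> \<sigma> Y X \<cdot> \<sigma> X Y = \<one> (X \<otimes> Y)"
    and hexagon: "\<lbrakk>X \<in> Obj C; Y \<in> Obj C; Z \<in> Obj C\<rbrakk> \<Longrightarrow>
      \<alpha> Y Z X \<cdot> \<sigma> X (Y \<otimes> Z) \<cdot> \<alpha> X Y Z =
      (\<one> Y \<boxtimes> \<sigma> X Z) \<cdot> \<alpha> Y X Z \<cdot> (\<sigma> X Y \<boxtimes> \<one> Z)"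

section \<open>Faithful strong symmetric monoidal functors\<close>

locale cat_functor = source: category C + target: category D
  for C :: "('o, 'a, 'm) cat_scheme" and D :: "('p, 'b, 'n) cat_scheme" +
  fixes Fo :: "'o \<Rightarrow> 'p" and Fa :: "'a \<Rightarrow> 'b"
  assumes Fo_Obj: "X \<in> Obj C \<Longrightarrow> Fo X \<in> Obj D"
    and Fa_Hom: "f \<in> Hom C X Y \<Longrightarrow> Fa f \<in> Hom D (Fo X) (Fo Y)"
    and Fa_Id: "X \<in> Obj C \<Longrightarrow> Fa (\<one>\<^bsub>C\<^esub> X) = \<one>\<^bsub>D\<^esub> (Fo X)"
    and Fa_Comp: "\<lbrakk>f \<in> Hom C X Y; g \<in> Hom C Y Z\<rbrakk> \<Longrightarrow> Fa (g \<cdot>\<^bsub>C\<^esub> f) = Fa g \<cdot>\<^bsub>D\<^esub> Fa f"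

locale strong_symmetric_monoidal_functor =
  cat_functor C D Fo Fa +
  source: symmetric_monoidal_category C + target: symmetric_monoidal_category D
  for C :: "('o, 'a, 'm) smcat_scheme" and D :: "('p, 'b, 'n) smcat_scheme"
    and Fo :: "'o \<Rightarrow> 'p" and Fa :: "'a \<Rightarrow> 'b" +
  fixes m :: "'o \<Rightarrow> 'o \<Rightarrow> 'b" and m\<^sub>I :: "'b"
  assumes m_Hom: "\<lbrakk>X \<in> Obj C; Y \<in> Obj C\<rbrakk> \<Longrightarrow>
      m X Y \<in> Hom D (Fo X \<otimes>\<^bsub>D\<^esub> Fo Y) (Fo (X \<otimes>\<^bsub>C\<^esub> Y))"
    and m_iso: "\<lbrakk>X \<in> Obj C; Y \<in> Obj C\<rbrakk> \<Longrightarrow> iso D (m X Y)"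
    and m_natural: "\<lbrakk>f \<in> Hom C X X'; g \<in> Hom C Y Y'\<rbrakk> \<Longrightarrow>
      Fa (f \<boxtimes>\<^bsub>C\<^esub> g) \<cdot>\<^bsub>D\<^esub> m X Y = m X' Y' \<cdot>\<^bsub>D\<^esub> (Fa f \<boxtimes>\<^bsub>D\<^esub> Fa g)"
    and m_unit_Hom: "m\<^sub>I \<in> Hom D \<I>\<^bsub>D\<^esub> (Fo \<I>\<^bsub>C\<^esub>)"
    and m_unit_iso: "iso D m\<^sub>I"
    and m_Assoc: "\<lbrakk>X \<in> Obj C; Y \<in> Obj C; Z \<in> Obj C\<rbrakk> \<Longrightarrow>
      Fa (\<alpha>\<^bsub>C\<^esub> X Y Z) \<cdot>\<^bsub>D\<^esub> m (X \<otimes>\<^bsub>C\<^esub> Y) Z \<cdot>\<^bsub>D\<^esub> (m X Y \<boxtimes>\<^bsub>D\<^esub> \<one>\<^bsub>D\<^esub> (Fo Z)) =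
      m X (Y \<otimes>\<^bsub>C\<^esub> Z) \<cdot>\<^bsub>D\<^esub> (\<one>\<^bsub>D\<^esub> (Fo X) \<boxtimes>\<^bsub>D\<^esub> m Y Z) \<cdot>\<^bsub>D\<^esub> \<alpha>\<^bsub>D\<^esub> (Fo X) (Fo Y) (Fo Z)"
    and m_Lunit: "X \<in> Obj C \<Longrightarrow>
      Fa (\<ll>\<^bsub>C\<^esub> X) \<cdot>\<^bsub>D\<^esub> m \<I>\<^bsub>C\<^esub> X \<cdot>\<^bsub>D\<^esub> (m\<^sub>I \<boxtimes>\<^bsub>D\<^esub> \<one>\<^bsub>D\<^esub> (Fo X)) = \<ll>\<^bsub>D\<^esub> (Fo X)"
    and m_Runit: "X \<in> Obj C \<Longrightarrow>
      Fa (\<rho>\<^bsub>C\<^esub> X) \<cdot>\<^bsub>D\<^esub> m X \<I>\<^bsub>C\<^esub> \<cdot>\<^bsub>D\<^esub> (\<one>\<^bsub>D\<^esub> (Fo X) \<boxtimes>\<^bsub>D\<^esub> m\<^sub>I) = \<rho>\<^bsub>D\<^esub> (Fo X)"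
    and m_Symm: "\<lbrakk>X \<in> Obj C; Y \<in> Obj C\<rbrakk> \<Longrightarrow>
      Fa (\<sigma>\<^bsub>C\<^esub> X Y) \<cdot>\<^bsub>D\<^esub> m X Y = m Y X \<cdot>\<^bsub>D\<^esub> \<sigma>\<^bsub>D\<^esub> (Fo X) (Fo Y)"

definition faithful :: "('o, 'a, 'm) cat_scheme \<Rightarrow> ('a \<Rightarrow> 'b) \<Rightarrow> bool" where
  "faithful C Fa \<longleftrightarrow> (\<forall>X\<in>Obj C. \<forall>Y\<in>Obj C. inj_on Fa (Hom C X Y))"

section \<open>Partial traces\<close>

text \<open>
  Partially defined expressions have option type, so Kleene equality is equality and
  the directed version is the following.
\<close>

definition kleene_le :: "'a option \<Rightarrow> 'a option \<Rightarrow> bool" (infix "\<lesssim>" 50) where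
  "a \<lesssim> b \<longleftrightarrow> a = None \<or> (\<exists>x. a = Some x \<and> b = Some x)"

text \<open>
  \<open>Tr U X Y\<close> is the partial function from \<open>Hom C (X \<otimes> U) (Y \<otimes> U)\<close> to \<open>Hom C X Y\<close>.
  It is not constrained when one of the indices is not an object.
\<close>

locale partially_traced_category = symmetric_monoidal_category C
  for C :: "('o, 'a, 'm) smcat_scheme" (structure) +
  fixes Tr :: "'o \<Rightarrow> 'o \<Rightarrow> 'o \<Rightarrow> 'a \<Rightarrow> 'a option"
  assumes Tr_dom: "\<lbrakk>U \<in> Obj C; X \<in> Obj C; Y \<in> Obj C; Tr U X Y f = Some t\<rbrakk> \<Longrightarrow>
      f \<in> Hom C (X \<otimes> U) (Y \<otimes> U)"
    and Tr_ran: "\<lbrakk>U \<in> Obj C; X \<in> Obj C; Y \<in> Obj C; Tr U X Y f = Some t\<rbrakk> \<Longrightarrow>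
      t \<in> Hom C X Y"
    and naturality: "\<lbrakk>U \<in> Obj C; X \<in> Obj C; Y \<in> Obj C; X' \<in> Obj C; Y' \<in> Obj C;
        f \<in> Hom C (X \<otimes> U) (Y \<otimes> U); g \<in> Hom C X' X; h \<in> Hom C Y Y'\<rbrakk> \<Longrightarrow>
      map_option (\<lambda>t. h \<cdot> t \<cdot> g) (Tr U X Y f) \<lesssim>
      Tr U X' Y' ((h \<boxtimes> \<one> U) \<cdot> f \<cdot> (g \<boxtimes> \<one> U))"
    and dinaturality: "\<lbrakk>U \<in> Obj C; U' \<in> Obj C; X \<in> Obj C; Y \<in> Obj C;
        f \<in> Hom C (X \<otimes> U) (Y \<otimes> U'); g \<in> Hom C U' U\<rbrakk> \<Longrightarrow>
      Tr U X Y ((\<one> Y \<boxtimes> g) \<cdot> f) = Tr U' X Y (f \<cdot> (\<one> X \<boxtimes> g))"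
    and vanishing_I: "\<lbrakk>X \<in> Obj C; Y \<in> Obj C; f \<in> Hom C (X \<otimes> \<I>) (Y \<otimes> \<I>)\<rbrakk> \<Longrightarrow>
      Tr \<I> X Y f = Some (\<rho> Y \<cdot> f \<cdot> Inv C (\<rho> X))"
    and vanishing_II: "\<lbrakk>U \<in> Obj C; V \<in> Obj C; X \<in> Obj C; Y \<in> Obj C;
        g \<in> Hom C ((X \<otimes> U) \<otimes> V) ((Y \<otimes> U) \<otimes> V);
        Tr V (X \<otimes> U) (Y \<otimes> U) g = Some t\<rbrakk> \<Longrightarrow>
      Tr (U \<otimes> V) X Y (\<alpha> Y U V \<cdot> g \<cdot> Inv C (\<alpha> X U V)) = Tr U X Y t"
    and superposing: "\<lbrakk>U \<in> Obj C; X \<in> Obj C; Y \<in> Obj C; W \<in> Obj C; Z \<in> Obj C;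
        f \<in> Hom C (X \<otimes> U) (Y \<otimes> U); g \<in> Hom C W Z\<rbrakk> \<Longrightarrow>
      map_option (\<lambda>t. g \<boxtimes> t) (Tr U X Y f) \<lesssim>
      Tr U (W \<otimes> X) (Z \<otimes> Y) (Inv C (\<alpha> Z Y U) \<cdot> (g \<boxtimes> f) \<cdot> \<alpha> W X U)"
    and yanking: "U \<in> Obj C \<Longrightarrow> Tr U U U (\<sigma> U U) = Some (\<one> U)"

section \<open>The trace induced along a functor\<close>

definition traced_image ::
  "('o, 'a, 'm) smcat_scheme \<Rightarrow> ('p, 'b, 'n) smcat_scheme \<Rightarrow> ('o \<Rightarrow> 'p) \<Rightarrow> ('a \<Rightarrow> 'b) \<Rightarrow>
   ('o \<Rightarrow> 'o \<Rightarrow> 'b) \<Rightarrow> ('p \<Rightarrow> 'p \<Rightarrow> 'p \<Rightarrow> 'b \<Rightarrow> 'b option) \<Rightarrow>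
   'o \<Rightarrow> 'o \<Rightarrow> 'o \<Rightarrow> 'a \<Rightarrow> 'b option" where
  "traced_image C D Fo Fa m Tr U X Y f =
     Tr (Fo U) (Fo X) (Fo Y) (Inv D (m Y U) \<cdot>\<^bsub>D\<^esub> Fa f \<cdot>\<^bsub>D\<^esub> m X U)"

definition induced_trace ::
  "('o, 'a, 'm) smcat_scheme \<Rightarrow> ('p, 'b, 'n) smcat_scheme \<Rightarrow> ('o \<Rightarrow> 'p) \<Rightarrow> ('a \<Rightarrow> 'b) \<Rightarrow>
   ('o \<Rightarrow> 'o \<Rightarrow> 'b) \<Rightarrow> ('p \<Rightarrow> 'p \<Rightarrow> 'p \<Rightarrow> 'b \<Rightarrow> 'b option) \<Rightarrow>
   'o \<Rightarrow> 'o \<Rightarrow> 'o \<Rightarrow> 'a \<Rightarrow> 'a option" where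
  "induced_trace C D Fo Fa m Tr U X Y f =
     (if f \<in> Hom C (X \<otimes>\<^bsub>C\<^esub> U) (Y \<otimes>\<^bsub>C\<^esub> U) \<and>
         (\<exists>g \<in> Hom C X Y. traced_image C D Fo Fa m Tr U X Y f = Some (Fa g))
      then Some (THE g. g \<in> Hom C X Y \<and> traced_image C D Fo Fa m Tr U X Y f = Some (Fa g))
      else None)"

text \<open>Faithfulness makes the description operator above well defined.\<close>

lemma induced_trace_eq_Some_iff:
  assumes "faithful C Fa" "X \<in> Obj C" "Y \<in> Obj C"
  shows "induced_trace C D Fo Fa m Tr U X Y f = Some g \<longleftrightarrow>
    f \<in> Hom C (X \<otimes>\<^bsub>C\<^esub> U) (Y \<otimes>\<^bsub>C\<^esub> U) \<and> g \<in> Hom C X Y \<and>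
    traced_image C D Fo Fa m Tr U X Y f = Some (Fa g)"
proof -
  let ?P = "\<lambda>g. g \<in> Hom C X Y \<and> traced_image C D Fo Fa m Tr U X Y f = Some (Fa g)"
  have uniq: "g = h" if "?P g" "?P h" for g h
    using assms that by (auto simp: faithful_def dest: inj_onD)
  have the: "(THE g. ?P g) = h" if "?P h" for h
    by (rule the_equality) (use that uniq in blast)+
  show ?thesis
  proof
    assume def: "induced_trace C D Fo Fa m Tr U X Y f = Some g"
    then have f: "f \<in> Hom C (X \<otimes>\<^bsub>C\<^esub> U) (Y \<otimes>\<^bsub>C\<^esub> U)" and "\<exists>h. ?P h"
      and g: "(THE g. ?P g) = g"
      unfolding induced_trace_def by (simp_all split: if_splits) blast
    then obtain h where "?P h"
      by blast
    with the g have "?P g"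
      by simp
    with f show "f \<in> Hom C (X \<otimes>\<^bsub>C\<^esub> U) (Y \<otimes>\<^bsub>C\<^esub> U) \<and> ?P g"
      by blast
  next
    assume "f \<in> Hom C (X \<otimes>\<^bsub>C\<^esub> U) (Y \<otimes>\<^bsub>C\<^esub> U) \<and> ?P g"
    with the show "induced_trace C D Fo Fa m Tr U X Y f = Some g"
      unfolding induced_trace_def by auto
  qed
qed

end

(*
  For f : X U -> Y V put f' = m^-1 F(f) m : FX FU -> FY FV. The passage from f to f' preserves
  composition and sends tensor products of arrows to tensor products of their images, and the
  induced trace of f is the preimage under F of the trace of f'. Each axiom for C then follows from
  the same axiom for D. The unit and the associator of C correspond to those of D only up to
  conjugation by structure maps; such conjugations are absorbed by naturality (in X and Y) and by
  dinaturality (in the traced object U).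
*)
theory Submission
  imports Defs
begin

section \<open>Categories: typing and cancellation rules in terms of \<open>Dom\<close> and
  \<open>Cod\<close>\<close>

lemma Hom_iff: "f \<in> Hom C X Y \<longleftrightarrow> f \<in> Arr C \<and> Dom C f = X \<and> Cod C f = Y"
  by (simp add: Hom_def)

text \<open>Turns the directed trace axioms into implications about defined values, so the undefined
  case needs no separate treatment.\<close>

lemma kleene_le_iff: "a \<lesssim> b \<longleftrightarrow> (\<forall>x. a = Some x \<longrightarrow> b = Some x)"
  by (cases a) (auto simp: kleene_le_def)

context category
begin

lemma Arr_Obj [simp]:
  assumes "f \<in> Arr C"
  shows "Dom C f \<in> Obj C" "Cod C f \<in> Obj C"
  using assms by (simp_all add: Dom_Obj Cod_Obj)

lemma Id_Arr [simp]:
  assumes "X \<in> Obj C"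
  shows "\<one> X \<in> Arr C" "Dom C (\<one> X) = X" "Cod C (\<one> X) = X"
  using Id_Hom[OF assms] by (simp_all add: Hom_iff)

text \<open>The middle object of \<open>Comp_Hom\<close> does not occur in its conclusion. With
  \<open>Dom\<close> and \<open>Cod\<close> in place of hom-sets, the arrows determine all objects
  and long composites can be typed by computation.\<close>

lemma Comp_Arr [simp]:
  assumes "f \<in> Arr C" "g \<in> Arr C" "Dom C g = Cod C f"
  shows "g \<cdot> f \<in> Arr C" "Dom C (g \<cdot> f) = Dom C f" "Cod C (g \<cdot> f) = Cod C g"
  using Comp_Hom[of f "Dom C f" "Cod C f" g "Cod C g"] assms by (simp_all add: Hom_iff)

lemma Comp_assoc_Arr [simp]:
  assumes "f \<in> Arr C" "g \<in> Arr C" "h \<in> Arr C" "Dom C g = Cod C f" "Dom C h = Cod C g"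
  shows "(h \<cdot> g) \<cdot> f = h \<cdot> (g \<cdot> f)"
  by (rule Comp_assoc) (use assms in \<open>auto simp: Hom_iff\<close>)

lemma Id_left_Arr [simp]: "\<lbrakk>f \<in> Arr C; Cod C f = Y\<rbrakk> \<Longrightarrow> \<one> Y \<cdot> f = f"
  by (rule Id_left) (auto simp: Hom_iff)

lemma Id_right_Arr [simp]: "\<lbrakk>f \<in> Arr C; Dom C f = X\<rbrakk> \<Longrightarrow> f \<cdot> \<one> X = f"
  by (rule Id_right) (auto simp: Hom_iff)

text \<open>Bracketing g f h in both ways gives g = h; this justifies the description in
  \<open>Inv\<close>.\<close>

lemma is_inverse_unique:
  assumes "f \<in> Arr C" "is_inverse C f g" "is_inverse C f h"
  shows "g = h"
proof -
  have "g = g \<cdot> (f \<cdot> h)"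
    using assms by (simp add: is_inverse_def Hom_iff)
  also have "\<dots> = (g \<cdot> f) \<cdot> h"
    using assms by (subst Comp_assoc_Arr) (simp_all add: is_inverse_def Hom_iff)
  also have "\<dots> = h"
    using assms by (simp add: is_inverse_def Hom_iff)
  finally show ?thesis .
qed

lemma is_inverse_Inv:
  assumes "iso C f"
  shows "is_inverse C f (Inv C f)"
proof -
  obtain g where g: "is_inverse C f g"
    using assms by (auto simp: iso_def)
  then show ?thesis
    unfolding Inv_def
    by (rule theI) (use assms g is_inverse_unique in \<open>auto simp: iso_def\<close>)
qed

lemma Inv_Arr [simp]:
  assumes "iso C f"
  shows "Inv C f \<in> Arr C" "Dom C (Inv C f) = Cod C f" "Cod C (Inv C f) = Dom C f"
    "Inv C f \<cdot> f = \<one> (Dom C f)" "f \<cdot> Inv C f = \<one> (Cod C f)"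
  using is_inverse_Inv[OF assms] by (simp_all add: is_inverse_def Hom_iff)

text \<open>Composites are normalised to the right, so a cancelling pair often stands in front of a
  further factor \<open>x\<close>.\<close>

lemma Inv_Comp_cancel [simp]:
  assumes "iso C f" "x \<in> Arr C" "Cod C x = Dom C f"
  shows "Inv C f \<cdot> (f \<cdot> x) = x"
proof -
  have "f \<in> Arr C"
    using assms by (simp add: iso_def)
  then have "Inv C f \<cdot> (f \<cdot> x) = (Inv C f \<cdot> f) \<cdot> x"
    using assms by (subst Comp_assoc_Arr) simp_all
  then show ?thesis
    using assms by simp
qed

lemma Comp_Inv_cancel [simp]:
  assumes "iso C f" "x \<in> Arr C" "Cod C x = Cod C f"
  shows "f \<cdot> (Inv C f \<cdot> x) = x"
proof -
  have "f \<in> Arr C"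
    using assms by (simp add: iso_def)
  then have "f \<cdot> (Inv C f \<cdot> x) = (f \<cdot> Inv C f) \<cdot> x"
    using assms by (subst Comp_assoc_Arr) simp_all
  then show ?thesis
    using assms by simp
qed

end

section \<open>Monoidal and symmetric monoidal categories: typing of tensors and structure maps,
  interchange\<close>

context monoidal_category
begin

lemmas Obj_simps [simp] = Unit_Obj TensorO_Obj

lemma TensorA_Arr [simp]:
  assumes "f \<in> Arr C" "g \<in> Arr C"
  shows "f \<boxtimes> g \<in> Arr C" "Dom C (f \<boxtimes> g) = Dom C f \<otimes> Dom C g"
    "Cod C (f \<boxtimes> g) = Cod C f \<otimes> Cod C g"
  using TensorA_Hom[of f "Dom C f" "Cod C f" g "Dom C g" "Cod C g"] assms
  by (simp_all add: Hom_iff)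

lemma TensorA_Id_Id [simp]: "\<lbrakk>X \<in> Obj C; Y \<in> Obj C\<rbrakk> \<Longrightarrow> \<one> X \<boxtimes> \<one> Y = \<one> (X \<otimes> Y)"
  by (rule TensorA_Id)

text \<open>Oriented to merge a composite of tensors into one tensor, so that mutually inverse
  factors meet in each component and cancel.\<close>

lemma interchange [simp]:
  assumes "f \<in> Arr C" "f' \<in> Arr C" "g \<in> Arr C" "g' \<in> Arr C"
    and "Dom C f' = Cod C f" "Dom C g' = Cod C g"
  shows "(f' \<boxtimes> g') \<cdot> (f \<boxtimes> g) = (f' \<cdot> f) \<boxtimes> (g' \<cdot> g)"
  by (rule TensorA_Comp[symmetric]) (use assms in \<open>auto simp: Hom_iff\<close>)

lemma interchange_Comp [simp]:
  assumes "f \<in> Arr C" "f' \<in> Arr C" "g \<in> Arr C" "g' \<in> Arr C"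
    and "Dom C f' = Cod C f" "Dom C g' = Cod C g"
    and "x \<in> Arr C" "Cod C x = Dom C f \<otimes> Dom C g"
  shows "(f' \<boxtimes> g') \<cdot> ((f \<boxtimes> g) \<cdot> x) = ((f' \<cdot> f) \<boxtimes> (g' \<cdot> g)) \<cdot> x"
proof -
  have "(f' \<boxtimes> g') \<cdot> ((f \<boxtimes> g) \<cdot> x) = ((f' \<boxtimes> g') \<cdot> (f \<boxtimes> g)) \<cdot> x"
    using assms by (subst Comp_assoc_Arr) simp_all
  then show ?thesis
    using assms by simp
qed

lemma Assoc_Arr [simp]:
  assumes "X \<in> Obj C" "Y \<in> Obj C" "Z \<in> Obj C"
  shows "\<alpha> X Y Z \<in> Arr C" "Dom C (\<alpha> X Y Z) = (X \<otimes> Y) \<otimes> Z"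
    "Cod C (\<alpha> X Y Z) = X \<otimes> (Y \<otimes> Z)" "iso C (\<alpha> X Y Z)"
  using Assoc_Hom[OF assms] Assoc_iso[OF assms] by (simp_all add: Hom_iff)

lemma Runit_Arr [simp]:
  assumes "X \<in> Obj C"
  shows "\<rho> X \<in> Arr C" "Dom C (\<rho> X) = X \<otimes> \<I>" "Cod C (\<rho> X) = X" "iso C (\<rho> X)"
  using Runit_Hom[OF assms] Runit_iso[OF assms] by (simp_all add: Hom_iff)

end

lemma (in symmetric_monoidal_category) Symm_Arr [simp]:
  assumes "X \<in> Obj C" "Y \<in> Obj C"
  shows "\<sigma> X Y \<in> Arr C" "Dom C (\<sigma> X Y) = X \<otimes> Y" "Cod C (\<sigma> X Y) = Y \<otimes> X"
  using Symm_Hom[OF assms] by (simp_all add: Hom_iff)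

section \<open>Partial traces: rules for defined values, change of the traced object\<close>

context partially_traced_category
begin

text \<open>A defined trace already types \<open>f\<close> by \<open>Tr_dom\<close>, and the
  directed axiom becomes an equation.\<close>

lemma Tr_naturality:
  assumes "U \<in> Obj C" "X \<in> Obj C" "Y \<in> Obj C" "Tr U X Y f = Some t"
    and "g \<in> Hom C X' X" "h \<in> Hom C Y Y'"
  shows "Tr U X' Y' ((h \<boxtimes> \<one> U) \<cdot> f \<cdot> (g \<boxtimes> \<one> U)) = Some (h \<cdot> t \<cdot> g)"
proof -
  have "X' \<in> Obj C" "Y' \<in> Obj C"
    using assms by (auto simp: Hom_iff)
  then show ?thesis
    using naturality[of U X Y X' Y' f g h] Tr_dom[of U X Y f t] assms
    by (simp add: kleene_le_iff)
qed

lemma Tr_superposing: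
  assumes "U \<in> Obj C" "X \<in> Obj C" "Y \<in> Obj C" "Tr U X Y f = Some t" "g \<in> Hom C W Z"
  shows "Tr U (W \<otimes> X) (Z \<otimes> Y) (Inv C (\<alpha> Z Y U) \<cdot> (g \<boxtimes> f) \<cdot> \<alpha> W X U) = Some (g \<boxtimes> t)"
proof -
  have "W \<in> Obj C" "Z \<in> Obj C"
    using assms by (auto simp: Hom_iff)
  then show ?thesis
    using superposing[of U X Y W Z f g] Tr_dom[of U X Y f t] assms
    by (simp add: kleene_le_iff)
qed

text \<open>Dinaturality carries \<open>\<phi>\<close> around the loop to the domain side, where it
  cancels its inverse. The traced object may thus be replaced by an isomorphic one.\<close>

lemma Tr_conjugate:
  assumes "X \<in> Obj C" "Y \<in> Obj C" "f \<in> Hom C (X \<otimes> U) (Y \<otimes> U)"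
    and "iso C \<phi>" "\<phi> \<in> Hom C U U'"
  shows "Tr U' X Y ((\<one> Y \<boxtimes> \<phi>) \<cdot> f \<cdot> (\<one> X \<boxtimes> Inv C \<phi>)) = Tr U X Y f"
proof -
  have U: "U \<in> Obj C" "U' \<in> Obj C"
    using assms by (auto simp: Hom_iff)
  \<comment> \<open>Bracketed so that dinaturality applies to the composite of \<open>f\<close> with
    \<open>\<one> X \<boxtimes> Inv C \<phi>\<close>, an arrow from X \<otimes> U' to Y \<otimes>
    U.\<close>
  have "Tr U' X Y ((\<one> Y \<boxtimes> \<phi>) \<cdot> (f \<cdot> (\<one> X \<boxtimes> Inv C \<phi>))) =
    Tr U X Y ((f \<cdot> (\<one> X \<boxtimes> Inv C \<phi>)) \<cdot> (\<one> X \<boxtimes> \<phi>))"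
    by (rule dinaturality) (use assms U in \<open>auto simp: Hom_iff\<close>)
  then show ?thesis
    using assms U by (simp add: Hom_iff)
qed

end

section \<open>Images of arrows and structure maps under the functor\<close>

context strong_symmetric_monoidal_functor
begin

lemma Fo_Obj_simp [simp]: "X \<in> Obj C \<Longrightarrow> Fo X \<in> Obj D"
  by (rule Fo_Obj)

lemma Fa_Arr [simp]:
  assumes "f \<in> Arr C"
  shows "Fa f \<in> Arr D" "Dom D (Fa f) = Fo (Dom C f)" "Cod D (Fa f) = Fo (Cod C f)"
  using Fa_Hom[of f "Dom C f" "Cod C f"] assms by (simp_all add: Hom_iff)

lemma Fa_Comp_Arr [simp]:
  assumes "f \<in> Arr C" "g \<in> Arr C" "Dom C g = Cod C f"
  shows "Fa (g \<cdot>\<^bsub>C\<^esub> f) = Fa g \<cdot>\<^bsub>D\<^esub> Fa f"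
  by (rule Fa_Comp) (use assms in \<open>auto simp: Hom_iff\<close>)

lemmas Fa_Id_simp [simp] = Fa_Id

lemma m_Arr [simp]:
  assumes "X \<in> Obj C" "Y \<in> Obj C"
  shows "m X Y \<in> Arr D" "Dom D (m X Y) = Fo X \<otimes>\<^bsub>D\<^esub> Fo Y"
    "Cod D (m X Y) = Fo (X \<otimes>\<^bsub>C\<^esub> Y)" "iso D (m X Y)"
  using m_Hom[OF assms] m_iso[OF assms] by (simp_all add: Hom_iff)

lemma m_unit_Arr [simp]:
  "m\<^sub>I \<in> Arr D" "Dom D m\<^sub>I = \<I>\<^bsub>D\<^esub>" "Cod D m\<^sub>I = Fo \<I>\<^bsub>C\<^esub>" "iso D m\<^sub>I"
  using m_unit_Hom m_unit_iso by (simp_all add: Hom_iff)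

text \<open>All four objects are arguments, since an object need not determine its splitting as a
  tensor product. Domain and codomain may be split differently, as associators require.\<close>

definition transport :: "'o \<Rightarrow> 'o \<Rightarrow> 'o \<Rightarrow> 'o \<Rightarrow> 'a \<Rightarrow> 'b" where
  "transport X U Y V f = Inv D (m Y V) \<cdot>\<^bsub>D\<^esub> Fa f \<cdot>\<^bsub>D\<^esub> m X U"

lemma transport_Arr [simp]:
  assumes "X \<in> Obj C" "U \<in> Obj C" "Y \<in> Obj C" "V \<in> Obj C"
    and "f \<in> Arr C" "Dom C f = X \<otimes>\<^bsub>C\<^esub> U" "Cod C f = Y \<otimes>\<^bsub>C\<^esub> V"
  shows "transport X U Y V f \<in> Arr D" "Dom D (transport X U Y V f) = Fo X \<otimes>\<^bsub>D\<^esub> Fo U"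
    "Cod D (transport X U Y V f) = Fo Y \<otimes>\<^bsub>D\<^esub> Fo V"
  using assms by (simp_all add: transport_def)

text \<open>The inner \<open>m Y V\<close> meets its inverse. The splitting of the middle object
  appears only on the right and has to be chosen at each use.\<close>

lemma transport_Comp:
  assumes "X \<in> Obj C" "U \<in> Obj C" "Y \<in> Obj C" "V \<in> Obj C" "Z \<in> Obj C" "W \<in> Obj C"
    and "f \<in> Hom C (X \<otimes>\<^bsub>C\<^esub> U) (Y \<otimes>\<^bsub>C\<^esub> V)" "g \<in> Hom C (Y \<otimes>\<^bsub>C\<^esub> V) (Z \<otimes>\<^bsub>C\<^esub> W)"
  shows "transport X U Z W (g \<cdot>\<^bsub>C\<^esub> f) = transport Y V Z W g \<cdot>\<^bsub>D\<^esub> transport X U Y V f"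
  using assms by (simp add: transport_def Hom_iff)

lemma transport_Id:
  assumes "X \<in> Obj C" "U \<in> Obj C"
  shows "transport X U X U (\<one>\<^bsub>C\<^esub> (X \<otimes>\<^bsub>C\<^esub> U)) = \<one>\<^bsub>D\<^esub> (Fo X \<otimes>\<^bsub>D\<^esub> Fo U)"
  using assms by (simp add: transport_def)

text \<open>By naturality, \<open>m\<close> slides past the image of the tensor and cancels against
  its inverse.\<close>

lemma transport_TensorA:
  assumes "f \<in> Hom C X Y" "g \<in> Hom C U V"
  shows "transport X U Y V (f \<boxtimes>\<^bsub>C\<^esub> g) = Fa f \<boxtimes>\<^bsub>D\<^esub> Fa g"
proof -
  have "X \<in> Obj C" "Y \<in> Obj C" "U \<in> Obj C" "V \<in> Obj C"
    using assms by (auto simp: Hom_iff)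
  then show ?thesis
    using m_natural[OF assms] assms by (simp add: transport_def Hom_iff)
qed

lemma transport_Symm:
  assumes "X \<in> Obj C" "Y \<in> Obj C"
  shows "transport X Y Y X (\<sigma>\<^bsub>C\<^esub> X Y) = \<sigma>\<^bsub>D\<^esub> (Fo X) (Fo Y)"
  using m_Symm[OF assms] assms by (simp add: transport_def)

text \<open>This is the coherence law \<open>m_Assoc\<close> solved for the image of the associator.
  The remaining factors act on the traced object on one side and on the parameter objects on the
  other.\<close>

lemma transport_Assoc:
  assumes "X \<in> Obj C" "Y \<in> Obj C" "Z \<in> Obj C"
  shows "transport (X \<otimes>\<^bsub>C\<^esub> Y) Z X (Y \<otimes>\<^bsub>C\<^esub> Z) (\<alpha>\<^bsub>C\<^esub> X Y Z) =
    (\<one>\<^bsub>D\<^esub> (Fo X) \<boxtimes>\<^bsub>D\<^esub> m Y Z) \<cdot>\<^bsub>D\<^esub> \<alpha>\<^bsub>D\<^esub> (Fo X) (Fo Y) (Fo Z) \<cdot>\<^bsub>D\<^esub>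
    (Inv D (m X Y) \<boxtimes>\<^bsub>D\<^esub> \<one>\<^bsub>D\<^esub> (Fo Z))"
    (is "?t = ?k \<cdot>\<^bsub>D\<^esub> ?a \<cdot>\<^bsub>D\<^esub> ?l")
proof -
  \<comment> \<open>Inserting \<open>m X Y \<boxtimes> \<one> (Fo Z)\<close> and its inverse exposes
    the left side of \<open>m_Assoc\<close>.\<close>
  have "?t = Inv D (m X (Y \<otimes>\<^bsub>C\<^esub> Z)) \<cdot>\<^bsub>D\<^esub>
      (Fa (\<alpha>\<^bsub>C\<^esub> X Y Z) \<cdot>\<^bsub>D\<^esub> m (X \<otimes>\<^bsub>C\<^esub> Y) Z \<cdot>\<^bsub>D\<^esub> (m X Y \<boxtimes>\<^bsub>D\<^esub> \<one>\<^bsub>D\<^esub> (Fo Z))) \<cdot>\<^bsub>D\<^esub> ?l"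
    using assms by (simp add: transport_def)
  also have "\<dots> = ?k \<cdot>\<^bsub>D\<^esub> ?a \<cdot>\<^bsub>D\<^esub> ?l"
    unfolding m_Assoc[OF assms] using assms by simp
  finally show ?thesis .
qed

text \<open>Both sides invert the transported associator: the left side from the left by
  functoriality, the right side from the right by \<open>transport_Assoc\<close>. Hence they
  agree.\<close>

lemma transport_Inv_Assoc:
  assumes "X \<in> Obj C" "Y \<in> Obj C" "Z \<in> Obj C"
  shows "transport X (Y \<otimes>\<^bsub>C\<^esub> Z) (X \<otimes>\<^bsub>C\<^esub> Y) Z (Inv C (\<alpha>\<^bsub>C\<^esub> X Y Z)) =
    (m X Y \<boxtimes>\<^bsub>D\<^esub> \<one>\<^bsub>D\<^esub> (Fo Z)) \<cdot>\<^bsub>D\<^esub> Inv D (\<alpha>\<^bsub>D\<^esub> (Fo X) (Fo Y) (Fo Z)) \<cdot>\<^bsub>D\<^esub>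
    (\<one>\<^bsub>D\<^esub> (Fo X) \<boxtimes>\<^bsub>D\<^esub> Inv D (m Y Z))"
    (is "?t = ?r")
proof -
  let ?a = "transport (X \<otimes>\<^bsub>C\<^esub> Y) Z X (Y \<otimes>\<^bsub>C\<^esub> Z) (\<alpha>\<^bsub>C\<^esub> X Y Z)"
  have "?a \<cdot>\<^bsub>D\<^esub> ?r = \<one>\<^bsub>D\<^esub> (Fo X \<otimes>\<^bsub>D\<^esub> Fo (Y \<otimes>\<^bsub>C\<^esub> Z))"
    using assms by (simp add: transport_Assoc)
  then have "?t = ?t \<cdot>\<^bsub>D\<^esub> (?a \<cdot>\<^bsub>D\<^esub> ?r)"
    using assms by simp
  also have "\<dots> = (?t \<cdot>\<^bsub>D\<^esub> ?a) \<cdot>\<^bsub>D\<^esub> ?r"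
    using assms by (subst target.Comp_assoc_Arr) simp_all
  also have "?t \<cdot>\<^bsub>D\<^esub> ?a = \<one>\<^bsub>D\<^esub> (Fo (X \<otimes>\<^bsub>C\<^esub> Y) \<otimes>\<^bsub>D\<^esub> Fo Z)"
    using assms
    by (simp add: transport_Comp[symmetric] Hom_iff transport_Id)
  also have "\<dots> \<cdot>\<^bsub>D\<^esub> ?r = ?r"
    using assms by simp
  finally show ?thesis .
qed

lemma Fa_Inv_Comp_Fa:
  assumes "iso C f"
  shows "Fa (Inv C f) \<cdot>\<^bsub>D\<^esub> Fa f = \<one>\<^bsub>D\<^esub> (Fo (Dom C f))"
  using assms by (simp add: Fa_Comp_Arr[symmetric] iso_def del: Fa_Comp_Arr)

text \<open>The coherence law \<open>m_Runit\<close> solved for the image of the right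
  unitor.\<close>

lemma Fa_Runit:
  assumes "X \<in> Obj C"
  shows "Fa (\<rho>\<^bsub>C\<^esub> X) =
    \<rho>\<^bsub>D\<^esub> (Fo X) \<cdot>\<^bsub>D\<^esub> (\<one>\<^bsub>D\<^esub> (Fo X) \<boxtimes>\<^bsub>D\<^esub> Inv D m\<^sub>I) \<cdot>\<^bsub>D\<^esub> Inv D (m X \<I>\<^bsub>C\<^esub>)"
  unfolding m_Runit[OF assms, symmetric] using assms by simp

text \<open>Again a left inverse and a right inverse of the same arrow, here of the image of the
  right unitor, must coincide.\<close>

lemma Fa_Inv_Runit:
  assumes "X \<in> Obj C"
  shows "Fa (Inv C (\<rho>\<^bsub>C\<^esub> X)) =
    m X \<I>\<^bsub>C\<^esub> \<cdot>\<^bsub>D\<^esub> (\<one>\<^bsub>D\<^esub> (Fo X) \<boxtimes>\<^bsub>D\<^esub> m\<^sub>I) \<cdot>\<^bsub>D\<^esub> Inv D (\<rho>\<^bsub>D\<^esub> (Fo X))"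
    (is "?t = ?r")
proof -
  have "Fa (\<rho>\<^bsub>C\<^esub> X) \<cdot>\<^bsub>D\<^esub> ?r = \<one>\<^bsub>D\<^esub> (Fo X)"
    using assms by (simp add: Fa_Runit)
  then have "?t = ?t \<cdot>\<^bsub>D\<^esub> (Fa (\<rho>\<^bsub>C\<^esub> X) \<cdot>\<^bsub>D\<^esub> ?r)"
    using assms by simp
  also have "\<dots> = (?t \<cdot>\<^bsub>D\<^esub> Fa (\<rho>\<^bsub>C\<^esub> X)) \<cdot>\<^bsub>D\<^esub> ?r"
    using assms by (subst target.Comp_assoc_Arr) simp_all
  also have "?t \<cdot>\<^bsub>D\<^esub> Fa (\<rho>\<^bsub>C\<^esub> X) = \<one>\<^bsub>D\<^esub> (Fo (X \<otimes>\<^bsub>C\<^esub> \<I>\<^bsub>C\<^esub>))"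
    using assms by (simp add: Fa_Inv_Comp_Fa)
  also have "\<dots> \<cdot>\<^bsub>D\<^esub> ?r = ?r"
    using assms by simp
  finally show ?thesis .
qed

end

section \<open>The induced trace and its axioms\<close>

locale faithful_functor_to_partially_traced =
  strong_symmetric_monoidal_functor C D Fo Fa m m\<^sub>I + target: partially_traced_category D Tr
  for C :: "('o, 'a, 'm) smcat_scheme" and D :: "('p, 'b, 'n) smcat_scheme"
    and Fo :: "'o \<Rightarrow> 'p" and Fa :: "'a \<Rightarrow> 'b"
    and m :: "'o \<Rightarrow> 'o \<Rightarrow> 'b" and m\<^sub>I :: "'b"
    and Tr :: "'p \<Rightarrow> 'p \<Rightarrow> 'p \<Rightarrow> 'b \<Rightarrow> 'b option" +
  assumes faithful: "faithful C Fa"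
begin

abbreviation ITr :: "'o \<Rightarrow> 'o \<Rightarrow> 'o \<Rightarrow> 'a \<Rightarrow> 'a option" where
  "ITr \<equiv> induced_trace C D Fo Fa m Tr"

lemma ITr_eq_Some_iff:
  assumes "X \<in> Obj C" "Y \<in> Obj C"
  shows "ITr U X Y f = Some g \<longleftrightarrow> f \<in> Hom C (X \<otimes>\<^bsub>C\<^esub> U) (Y \<otimes>\<^bsub>C\<^esub> U) \<and> g \<in> Hom C X Y \<and>
    Tr (Fo U) (Fo X) (Fo Y) (transport X U Y U f) = Some (Fa g)"
  using induced_trace_eq_Some_iff[OF faithful assms]
  by (simp add: traced_image_def transport_def)

text \<open>Equal traces in \<open>D\<close> have the same preimages under \<open>Fa\<close>. As the
  hypothesis compares option values, it also covers the case where both traces are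
  undefined.\<close>

lemma ITr_cong:
  assumes "X \<in> Obj C" "Y \<in> Obj C"
    and "f \<in> Hom C (X \<otimes>\<^bsub>C\<^esub> U) (Y \<otimes>\<^bsub>C\<^esub> U)" "f' \<in> Hom C (X \<otimes>\<^bsub>C\<^esub> U') (Y \<otimes>\<^bsub>C\<^esub> U')"
    and "Tr (Fo U) (Fo X) (Fo Y) (transport X U Y U f) =
      Tr (Fo U') (Fo X) (Fo Y) (transport X U' Y U' f')"
  shows "ITr U X Y f = ITr U' X Y f'"
proof -
  have "ITr U X Y f = Some g \<longleftrightarrow> ITr U' X Y f' = Some g" for g
    using assms by (simp add: ITr_eq_Some_iff)
  then show ?thesis
    by (metis option.exhaust)
qed

text \<open>Transport turns the two arguments into the two sides of dinaturality in \<open>D\<close>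
  for \<open>Fa g\<close>.\<close>

lemma ITr_dinaturality:
  assumes "U \<in> Obj C" "U' \<in> Obj C" "X \<in> Obj C" "Y \<in> Obj C"
    and "f \<in> Hom C (X \<otimes>\<^bsub>C\<^esub> U) (Y \<otimes>\<^bsub>C\<^esub> U')" "g \<in> Hom C U' U"
  shows "ITr U X Y ((\<one>\<^bsub>C\<^esub> Y \<boxtimes>\<^bsub>C\<^esub> g) \<cdot>\<^bsub>C\<^esub> f) = ITr U' X Y (f \<cdot>\<^bsub>C\<^esub> (\<one>\<^bsub>C\<^esub> X \<boxtimes>\<^bsub>C\<^esub> g))"
proof (rule ITr_cong)
  let ?f = "transport X U Y U' f"
  have "transport X U Y U ((\<one>\<^bsub>C\<^esub> Y \<boxtimes>\<^bsub>C\<^esub> g) \<cdot>\<^bsub>C\<^esub> f) = (\<one>\<^bsub>D\<^esub> (Fo Y) \<boxtimes>\<^bsub>D\<^esub> Fa g) \<cdot>\<^bsub>D\<^esub> ?f"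
    "transport X U' Y U' (f \<cdot>\<^bsub>C\<^esub> (\<one>\<^bsub>C\<^esub> X \<boxtimes>\<^bsub>C\<^esub> g)) = ?f \<cdot>\<^bsub>D\<^esub> (\<one>\<^bsub>D\<^esub> (Fo X) \<boxtimes>\<^bsub>D\<^esub> Fa g)"
    using assms
    by (simp_all add: Hom_iff transport_TensorA
        transport_Comp[where Y = Y and V = U'] transport_Comp[where Y = X and V = U])
  then show "Tr (Fo U) (Fo X) (Fo Y) (transport X U Y U ((\<one>\<^bsub>C\<^esub> Y \<boxtimes>\<^bsub>C\<^esub> g) \<cdot>\<^bsub>C\<^esub> f)) =
    Tr (Fo U') (Fo X) (Fo Y) (transport X U' Y U' (f \<cdot>\<^bsub>C\<^esub> (\<one>\<^bsub>C\<^esub> X \<boxtimes>\<^bsub>C\<^esub> g)))"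
    using target.dinaturality[of "Fo U" "Fo U'" "Fo X" "Fo Y" ?f "Fa g"] assms
    by (simp add: Hom_iff)
qed (use assms in \<open>auto simp: Hom_iff\<close>)

text \<open>The preimage required in \<open>C\<close> exists because \<open>Fa t\<close> composed
  with \<open>Fa h\<close> and \<open>Fa g\<close> is the image of the corresponding
  composite.\<close>

lemma ITr_naturality:
  assumes "U \<in> Obj C" "X \<in> Obj C" "Y \<in> Obj C" "X' \<in> Obj C" "Y' \<in> Obj C"
    and "g \<in> Hom C X' X" "h \<in> Hom C Y Y'" and t: "ITr U X Y f = Some t"
  shows "ITr U X' Y' ((h \<boxtimes>\<^bsub>C\<^esub> \<one>\<^bsub>C\<^esub> U) \<cdot>\<^bsub>C\<^esub> f \<cdot>\<^bsub>C\<^esub> (g \<boxtimes>\<^bsub>C\<^esub> \<one>\<^bsub>C\<^esub> U)) = Some (h \<cdot>\<^bsub>C\<^esub> t \<cdot>\<^bsub>C\<^esub> g)"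
proof -
  let ?f = "transport X U Y U f"
  have f: "f \<in> Hom C (X \<otimes>\<^bsub>C\<^esub> U) (Y \<otimes>\<^bsub>C\<^esub> U)" "t \<in> Hom C X Y"
    and Ft: "Tr (Fo U) (Fo X) (Fo Y) ?f = Some (Fa t)"
    using t assms by (simp_all add: ITr_eq_Some_iff)
  have "transport X' U Y' U ((h \<boxtimes>\<^bsub>C\<^esub> \<one>\<^bsub>C\<^esub> U) \<cdot>\<^bsub>C\<^esub> f \<cdot>\<^bsub>C\<^esub> (g \<boxtimes>\<^bsub>C\<^esub> \<one>\<^bsub>C\<^esub> U)) =
      (Fa h \<boxtimes>\<^bsub>D\<^esub> \<one>\<^bsub>D\<^esub> (Fo U)) \<cdot>\<^bsub>D\<^esub> ?f \<cdot>\<^bsub>D\<^esub> (Fa g \<boxtimes>\<^bsub>D\<^esub> \<one>\<^bsub>D\<^esub> (Fo U))"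
    using assms f
    by (simp add: Hom_iff transport_TensorA
        transport_Comp[where Y = Y and V = U] transport_Comp[where Y = X and V = U])
  with target.Tr_naturality[OF _ _ _ Ft, of "Fa g" "Fo X'" "Fa h" "Fo Y'"]
  show ?thesis
    using assms f by (simp add: ITr_eq_Some_iff Hom_iff)
qed

text \<open>Conjugation by \<open>m\<^sub>I\<close> replaces the traced object by the unit of
  \<open>D\<close>. Vanishing I there always gives a value, and the unit coherence shows that it
  lies in the image of \<open>Fa\<close>.\<close>

lemma ITr_vanishing_I:
  assumes "X \<in> Obj C" "Y \<in> Obj C" "f \<in> Hom C (X \<otimes>\<^bsub>C\<^esub> \<I>\<^bsub>C\<^esub>) (Y \<otimes>\<^bsub>C\<^esub> \<I>\<^bsub>C\<^esub>)"
  shows "ITr \<I>\<^bsub>C\<^esub> X Y f = Some (\<rho>\<^bsub>C\<^esub> Y \<cdot>\<^bsub>C\<^esub> f \<cdot>\<^bsub>C\<^esub> Inv C (\<rho>\<^bsub>C\<^esub> X))"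
proof -
  let ?f = "transport X \<I>\<^bsub>C\<^esub> Y \<I>\<^bsub>C\<^esub> f"
  let ?f' = "(\<one>\<^bsub>D\<^esub> (Fo Y) \<boxtimes>\<^bsub>D\<^esub> Inv D m\<^sub>I) \<cdot>\<^bsub>D\<^esub> ?f \<cdot>\<^bsub>D\<^esub> (\<one>\<^bsub>D\<^esub> (Fo X) \<boxtimes>\<^bsub>D\<^esub> m\<^sub>I)"
  have f': "?f' \<in> Hom D (Fo X \<otimes>\<^bsub>D\<^esub> \<I>\<^bsub>D\<^esub>) (Fo Y \<otimes>\<^bsub>D\<^esub> \<I>\<^bsub>D\<^esub>)"
    using assms by (simp add: Hom_iff)
  have "?f = (\<one>\<^bsub>D\<^esub> (Fo Y) \<boxtimes>\<^bsub>D\<^esub> m\<^sub>I) \<cdot>\<^bsub>D\<^esub> ?f' \<cdot>\<^bsub>D\<^esub> (\<one>\<^bsub>D\<^esub> (Fo X) \<boxtimes>\<^bsub>D\<^esub> Inv D m\<^sub>I)"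
    using assms by (simp add: Hom_iff)
  then have "Tr (Fo \<I>\<^bsub>C\<^esub>) (Fo X) (Fo Y) ?f = Tr \<I>\<^bsub>D\<^esub> (Fo X) (Fo Y) ?f'"
    using target.Tr_conjugate[OF _ _ f', of m\<^sub>I "Fo \<I>\<^bsub>C\<^esub>"] assms by (simp add: Hom_iff)
  also have "\<dots> = Some (\<rho>\<^bsub>D\<^esub> (Fo Y) \<cdot>\<^bsub>D\<^esub> ?f' \<cdot>\<^bsub>D\<^esub> Inv D (\<rho>\<^bsub>D\<^esub> (Fo X)))"
    using assms f' by (intro target.vanishing_I) simp_all
  also have "\<rho>\<^bsub>D\<^esub> (Fo Y) \<cdot>\<^bsub>D\<^esub> ?f' \<cdot>\<^bsub>D\<^esub> Inv D (\<rho>\<^bsub>D\<^esub> (Fo X)) =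
      Fa (\<rho>\<^bsub>C\<^esub> Y \<cdot>\<^bsub>C\<^esub> f \<cdot>\<^bsub>C\<^esub> Inv C (\<rho>\<^bsub>C\<^esub> X))"
    using assms by (simp add: Fa_Runit Fa_Inv_Runit Hom_iff transport_def)
  finally show ?thesis
    using assms by (simp add: ITr_eq_Some_iff Hom_iff)
qed

text \<open>The factors \<open>m U V\<close> from the associators conjugate the traced object and
  vanish by dinaturality. The factors \<open>m X U\<close> and \<open>m Y U\<close> are absorbed
  into the inner trace by naturality.\<close>

lemma ITr_vanishing_II:
  assumes "U \<in> Obj C" "V \<in> Obj C" "X \<in> Obj C" "Y \<in> Obj C"
    and t: "ITr V (X \<otimes>\<^bsub>C\<^esub> U) (Y \<otimes>\<^bsub>C\<^esub> U) g = Some t"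
  shows "ITr (U \<otimes>\<^bsub>C\<^esub> V) X Y (\<alpha>\<^bsub>C\<^esub> Y U V \<cdot>\<^bsub>C\<^esub> g \<cdot>\<^bsub>C\<^esub> Inv C (\<alpha>\<^bsub>C\<^esub> X U V)) = ITr U X Y t"
proof (rule ITr_cong)
  let ?XU = "X \<otimes>\<^bsub>C\<^esub> U" and ?YU = "Y \<otimes>\<^bsub>C\<^esub> U" and ?UV = "U \<otimes>\<^bsub>C\<^esub> V"
  let ?g = "transport ?XU V ?YU V g"
  let ?g' = "(Inv D (m Y U) \<boxtimes>\<^bsub>D\<^esub> \<one>\<^bsub>D\<^esub> (Fo V)) \<cdot>\<^bsub>D\<^esub> ?g \<cdot>\<^bsub>D\<^esub> (m X U \<boxtimes>\<^bsub>D\<^esub> \<one>\<^bsub>D\<^esub> (Fo V))"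
  let ?h = "\<alpha>\<^bsub>D\<^esub> (Fo Y) (Fo U) (Fo V) \<cdot>\<^bsub>D\<^esub> ?g' \<cdot>\<^bsub>D\<^esub> Inv D (\<alpha>\<^bsub>D\<^esub> (Fo X) (Fo U) (Fo V))"
  let ?k = "\<alpha>\<^bsub>C\<^esub> Y U V \<cdot>\<^bsub>C\<^esub> g \<cdot>\<^bsub>C\<^esub> Inv C (\<alpha>\<^bsub>C\<^esub> X U V)"
  have g: "g \<in> Hom C (?XU \<otimes>\<^bsub>C\<^esub> V) (?YU \<otimes>\<^bsub>C\<^esub> V)" and tH: "t \<in> Hom C ?XU ?YU"
    and Ft: "Tr (Fo V) (Fo ?XU) (Fo ?YU) ?g = Some (Fa t)"
    using t assms by (simp_all add: ITr_eq_Some_iff)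
  show "?k \<in> Hom C (X \<otimes>\<^bsub>C\<^esub> ?UV) (Y \<otimes>\<^bsub>C\<^esub> ?UV)" "t \<in> Hom C ?XU ?YU"
    using assms g tH by (simp_all add: Hom_iff)
  have g': "?g' \<in> Hom D ((Fo X \<otimes>\<^bsub>D\<^esub> Fo U) \<otimes>\<^bsub>D\<^esub> Fo V) ((Fo Y \<otimes>\<^bsub>D\<^esub> Fo U) \<otimes>\<^bsub>D\<^esub> Fo V)"
    using assms g by (simp add: Hom_iff)
  have "transport X ?UV Y ?UV ?k = transport ?YU V Y ?UV (\<alpha>\<^bsub>C\<^esub> Y U V) \<cdot>\<^bsub>D\<^esub>
      (?g \<cdot>\<^bsub>D\<^esub> transport X ?UV ?XU V (Inv C (\<alpha>\<^bsub>C\<^esub> X U V)))"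
    using assms g
    by (simp add: Hom_iff transport_Comp[where Y = ?YU and V = V] transport_Comp[where Y = ?XU and V = V])
  also have "\<dots> = (\<one>\<^bsub>D\<^esub> (Fo Y) \<boxtimes>\<^bsub>D\<^esub> m U V) \<cdot>\<^bsub>D\<^esub> ?h \<cdot>\<^bsub>D\<^esub> (\<one>\<^bsub>D\<^esub> (Fo X) \<boxtimes>\<^bsub>D\<^esub> Inv D (m U V))"
    using assms g by (simp add: transport_Assoc transport_Inv_Assoc Hom_iff)
  finally have k: "transport X ?UV Y ?UV ?k =
      (\<one>\<^bsub>D\<^esub> (Fo Y) \<boxtimes>\<^bsub>D\<^esub> m U V) \<cdot>\<^bsub>D\<^esub> ?h \<cdot>\<^bsub>D\<^esub> (\<one>\<^bsub>D\<^esub> (Fo X) \<boxtimes>\<^bsub>D\<^esub> Inv D (m U V))" .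
  have "Tr (Fo ?UV) (Fo X) (Fo Y) (transport X ?UV Y ?UV ?k) =
      Tr (Fo U \<otimes>\<^bsub>D\<^esub> Fo V) (Fo X) (Fo Y) ?h"
    unfolding k by (rule target.Tr_conjugate) (use assms g in \<open>simp_all add: Hom_iff\<close>)
  also have "\<dots> = Tr (Fo U) (Fo X) (Fo Y) (transport X U Y U t)"
  proof (rule target.vanishing_II)
    \<comment> \<open>Naturality conjugates the inner trace \<open>Fa t\<close> by
      \<open>m X U\<close> and \<open>m Y U\<close>, which yields exactly the transport of
      \<open>t\<close>.\<close>
    show "Tr (Fo V) (Fo X \<otimes>\<^bsub>D\<^esub> Fo U) (Fo Y \<otimes>\<^bsub>D\<^esub> Fo U) ?g' = Some (transport X U Y U t)"
      unfolding transport_def[of X U Y U t]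
      by (rule target.Tr_naturality[OF _ _ _ Ft]) (simp_all add: assms Hom_iff)
  qed (simp_all add: assms g')
  finally show "Tr (Fo ?UV) (Fo X) (Fo Y) (transport X ?UV Y ?UV ?k) =
      Tr (Fo U) (Fo X) (Fo Y) (transport X U Y U t)" .
qed (use assms in simp_all)

text \<open>The factors of the associators on the traced side combine with \<open>Fa f\<close> into
  the transport of \<open>f\<close>. The outer factors \<open>m W X\<close> and \<open>m Z Y\<close>
  pass out of the trace by naturality.\<close>

lemma ITr_superposing:
  assumes "U \<in> Obj C" "X \<in> Obj C" "Y \<in> Obj C" "W \<in> Obj C" "Z \<in> Obj C"
    and g: "g \<in> Hom C W Z" and t: "ITr U X Y f = Some t"
  shows "ITr U (W \<otimes>\<^bsub>C\<^esub> X) (Z \<otimes>\<^bsub>C\<^esub> Y) (Inv C (\<alpha>\<^bsub>C\<^esub> Z Y U) \<cdot>\<^bsub>C\<^esub> (g \<boxtimes>\<^bsub>C\<^esub> f) \<cdot>\<^bsub>C\<^esub> \<alpha>\<^bsub>C\<^esub> W X U) =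
    Some (g \<boxtimes>\<^bsub>C\<^esub> t)"
proof -
  let ?WX = "W \<otimes>\<^bsub>C\<^esub> X" and ?ZY = "Z \<otimes>\<^bsub>C\<^esub> Y" and ?XU = "X \<otimes>\<^bsub>C\<^esub> U" and ?YU = "Y \<otimes>\<^bsub>C\<^esub> U"
  let ?f = "transport X U Y U f"
  let ?k = "Inv C (\<alpha>\<^bsub>C\<^esub> Z Y U) \<cdot>\<^bsub>C\<^esub> (g \<boxtimes>\<^bsub>C\<^esub> f) \<cdot>\<^bsub>C\<^esub> \<alpha>\<^bsub>C\<^esub> W X U"
  let ?h = "Inv D (\<alpha>\<^bsub>D\<^esub> (Fo Z) (Fo Y) (Fo U)) \<cdot>\<^bsub>D\<^esub> (Fa g \<boxtimes>\<^bsub>D\<^esub> ?f) \<cdot>\<^bsub>D\<^esub> \<alpha>\<^bsub>D\<^esub> (Fo W) (Fo X) (Fo U)"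
  have f: "f \<in> Hom C ?XU ?YU" and tH: "t \<in> Hom C X Y"
    and Ft: "Tr (Fo U) (Fo X) (Fo Y) ?f = Some (Fa t)"
    using t assms by (simp_all add: ITr_eq_Some_iff)
  have "transport ?WX U ?ZY U ?k = transport Z ?YU ?ZY U (Inv C (\<alpha>\<^bsub>C\<^esub> Z Y U)) \<cdot>\<^bsub>D\<^esub>
      (transport W ?XU Z ?YU (g \<boxtimes>\<^bsub>C\<^esub> f) \<cdot>\<^bsub>D\<^esub> transport ?WX U W ?XU (\<alpha>\<^bsub>C\<^esub> W X U))"
    using assms f
    by (simp add: Hom_iff transport_Comp[where Y = Z and V = ?YU] transport_Comp[where Y = W and V = ?XU])
  also have "\<dots> =
      (m Z Y \<boxtimes>\<^bsub>D\<^esub> \<one>\<^bsub>D\<^esub> (Fo U)) \<cdot>\<^bsub>D\<^esub> ?h \<cdot>\<^bsub>D\<^esub> (Inv D (m W X) \<boxtimes>\<^bsub>D\<^esub> \<one>\<^bsub>D\<^esub> (Fo U))"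
    using assms f
    by (simp add: transport_TensorA[OF g f] transport_Assoc transport_Inv_Assoc
        transport_def[of X U Y U f] Hom_iff)
  finally have k: "transport ?WX U ?ZY U ?k =
      (m Z Y \<boxtimes>\<^bsub>D\<^esub> \<one>\<^bsub>D\<^esub> (Fo U)) \<cdot>\<^bsub>D\<^esub> ?h \<cdot>\<^bsub>D\<^esub> (Inv D (m W X) \<boxtimes>\<^bsub>D\<^esub> \<one>\<^bsub>D\<^esub> (Fo U))" .
  have "Tr (Fo U) (Fo ?WX) (Fo ?ZY) (transport ?WX U ?ZY U ?k) =
      Some (m Z Y \<cdot>\<^bsub>D\<^esub> (Fa g \<boxtimes>\<^bsub>D\<^esub> Fa t) \<cdot>\<^bsub>D\<^esub> Inv D (m W X))"
    unfolding k
  proof (rule target.Tr_naturality)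
    show "Tr (Fo U) (Fo W \<otimes>\<^bsub>D\<^esub> Fo X) (Fo Z \<otimes>\<^bsub>D\<^esub> Fo Y) ?h = Some (Fa g \<boxtimes>\<^bsub>D\<^esub> Fa t)"
      by (rule target.Tr_superposing[OF _ _ _ Ft]) (use assms in \<open>simp_all add: Hom_iff\<close>)
  qed (use assms in \<open>simp_all add: Hom_iff\<close>)
  \<comment> \<open>Naturality of \<open>m\<close> provides the preimage in
    \<open>C\<close>.\<close>
  also have "m Z Y \<cdot>\<^bsub>D\<^esub> (Fa g \<boxtimes>\<^bsub>D\<^esub> Fa t) \<cdot>\<^bsub>D\<^esub> Inv D (m W X) = Fa (g \<boxtimes>\<^bsub>C\<^esub> t)"
    unfolding m_natural[OF g tH, symmetric] using assms tH by (simp add: Hom_iff)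
  finally show ?thesis
    using assms f tH by (simp add: ITr_eq_Some_iff Hom_iff)
qed

text \<open>Compatibility of \<open>m\<close> with the symmetry makes the transported symmetry that
  of \<open>D\<close>, whose trace is the image of an identity.\<close>

lemma ITr_yanking:
  assumes "U \<in> Obj C"
  shows "ITr U U U (\<sigma>\<^bsub>C\<^esub> U U) = Some (\<one>\<^bsub>C\<^esub> U)"
  using assms by (simp add: ITr_eq_Some_iff transport_Symm target.yanking Hom_iff)

lemma partially_traced_ITr: "partially_traced_category C ITr"
proof unfold_locales
  fix U X Y f t
  assume "U \<in> Obj C" "X \<in> Obj C" "Y \<in> Obj C" "ITr U X Y f = Some t"
  then show "f \<in> Hom C (X \<otimes>\<^bsub>C\<^esub> U) (Y \<otimes>\<^bsub>C\<^esub> U)" "t \<in> Hom C X Y"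
    by (simp_all add: ITr_eq_Some_iff)
qed (auto simp: kleene_le_iff ITr_naturality ITr_dinaturality ITr_vanishing_I ITr_vanishing_II
    ITr_superposing ITr_yanking)

end

theorem proposition4p3p1:
  fixes C :: "('o, 'a, 'm) smcat_scheme" and D :: "('p, 'b, 'n) smcat_scheme"
    and Fo :: "'o \<Rightarrow> 'p" and Fa :: "'a \<Rightarrow> 'b"
    and m :: "'o \<Rightarrow> 'o \<Rightarrow> 'b" and m\<^sub>I :: "'b"
    and Tr :: "'p \<Rightarrow> 'p \<Rightarrow> 'p \<Rightarrow> 'b \<Rightarrow> 'b option"
  assumes "partially_traced_category D Tr"
    and "symmetric_monoidal_category C"
    and "strong_symmetric_monoidal_functor C D Fo Fa m m\<^sub>I"
    and "faithful C Fa"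
  shows "partially_traced_category C (induced_trace C D Fo Fa m Tr)"
proof -
  interpret faithful_functor_to_partially_traced C D Fo Fa m m\<^sub>I Tr
    using assms
    by (simp add: faithful_functor_to_partially_traced_def
        faithful_functor_to_partially_traced_axioms_def)
  show ?thesis
    by (rule partially_traced_ITr)
qed

end
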